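(* Let $\mathbb G=\langle g\rangle$ be a cyclic group of prime order $p$, written multiplicatively, and let $h\in\mathbb G$. Let $\mathcal X=\mathbb G^2$, $\mathcal L=\{(g^r,h^r): r\in\mathbb Z_p\}$ and $\mathcal L'=\mathcal X\setminus\mathcal L$. For a hash key $\mathsf{hk}=(\alpha,\beta)$ drawn uniformly from $\mathbb Z_p^2$, define the projection key $\mathsf{hp}=g^\alpha h^\beta$, the hash value $\mathsf{Hash}(\mathsf{hk},(u,v))=u^\alpha v^\beta$ for $(u,v)\in\mathcal X$, and the projected hash value $\mathsf{ProjHash}(\mathsf{hp},x,r)=\mathsf{hp}^r$ for $x=(g^r,h^r)\in\mathcal L$. Then: 1. (Correctness) For every $x=(g^r,h^r)\in\mathcal L$ with witness $r$ and every $\mathsf{hk}=(\alpha,\beta)$, $\mathsf{Hash}(\mathsf{hk},x)=\mathsf{ProjHash}(\mathsf{hp},x,r)$. 2. (Smoothness) For every $x\in\mathcal X\setminus\mathcal L$, the distribution of $(\mathsf{hp},\mathsf{Hash}(\mathsf{hk},x))$ over uniform $\mathsf{hk}\in\mathbb Z_p^2$ is identical to the distribution of $(\mathsf{hp},v)$ with $v$ uniform in $\mathbb G$ and independent of $\mathsf{hp}$. 3. (Statistical decomposition intractability) For $\rho$ uniformly random in $\mathbb G^2$, the probability that there exist $x,y\in\mathcal X$ with $x,y\notin\mathcal L'$ and $x\cdot y=\rho$ (componentwise product) is at most $1/p$. In particular this holds even for an adversary knowing the discrete logarithm of $h$ in base $g$.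
   Context: This is the Smooth Projective Hash Function with Grey Zone built from ElGamal encryption: the public key is $h=g^{\mathsf{sk}}$; an encryption of $M\in\mathbb G$ with randomness $r\in\mathbb Z_p$ is $(g^r,h^r M)$; decryption of $(c_0,c_1)$ is $c_1/c_0^{\mathsf{sk}}$. Thus $\mathcal L$ is the set of encryptions of $1=g^0$, and $\mathcal L'$ is the set of ciphertexts that do not decrypt to $1$ (the grey zone $\mathcal X\setminus(\mathcal L\cup\mathcal L')$ is empty). The complement of a word $x\in\mathcal X$ with respect to $\rho\in\mathbb G^2$ is the word $y$ with $x\cdot y=\rho$ componentwise. Decomposition intractability of a Smooth Projective Hash Function with Grey Zone asks that, for random $\rho$, one cannot find a word $x\notin\mathcal L'$ whose complement is also outside $\mathcal L'$. *)

theory Defs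
  imports "HOL-Algebra.Generated_Groups" "HOL-Probability.Probability" "HOL-Computational_Algebra.Primes"
begin

text \<open>
  Elements of \<open>\<int>\<^sub>p\<close> are represented by their canonical representatives. When the group has
  order \<open>p\<close>, group powers depend only on the exponent modulo \<open>p\<close>.
\<close>

definition Zp :: "nat \<Rightarrow> nat set" where
  "Zp p = {..<p}"

definition word_set :: "('a, 'b) monoid_scheme \<Rightarrow> ('a \<times> 'a) set" where
  "word_set G = carrier (G \<times>\<times> G)"

definition lang :: "('a, 'b) monoid_scheme \<Rightarrow> 'a \<Rightarrow> 'a \<Rightarrow> nat \<Rightarrow> ('a \<times> 'a) set" where
  "lang G g h p = {(g [^]\<^bsub>G\<^esub> r, h [^]\<^bsub>G\<^esub> r) | r. r \<in> Zp p}"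

definition lang' :: "('a, 'b) monoid_scheme \<Rightarrow> 'a \<Rightarrow> 'a \<Rightarrow> nat \<Rightarrow> ('a \<times> 'a) set" where
  "lang' G g h p = word_set G - lang G g h p"

definition hash_key :: "nat \<Rightarrow> (nat \<times> nat) pmf" where
  "hash_key p = pmf_of_set (Zp p \<times> Zp p)"

fun proj_key :: "('a, 'b) monoid_scheme \<Rightarrow> 'a \<Rightarrow> 'a \<Rightarrow> nat \<times> nat \<Rightarrow> 'a" where
  "proj_key G g h (\<alpha>, \<beta>) = g [^]\<^bsub>G\<^esub> \<alpha> \<otimes>\<^bsub>G\<^esub> h [^]\<^bsub>G\<^esub> \<beta>"

fun hash_val :: "('a, 'b) monoid_scheme \<Rightarrow> nat \<times> nat \<Rightarrow> 'a \<times> 'a \<Rightarrow> 'a" where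
  "hash_val G (\<alpha>, \<beta>) (u, v) = u [^]\<^bsub>G\<^esub> \<alpha> \<otimes>\<^bsub>G\<^esub> v [^]\<^bsub>G\<^esub> \<beta>"

definition proj_hash :: "('a, 'b) monoid_scheme \<Rightarrow> 'a \<Rightarrow> 'a \<times> 'a \<Rightarrow> nat \<Rightarrow> 'a" where
  "proj_hash G hp x r = hp [^]\<^bsub>G\<^esub> r"

definition decomposition ::
  "('a, 'b) monoid_scheme \<Rightarrow> 'a \<Rightarrow> 'a \<Rightarrow> nat \<Rightarrow> 'a \<times> 'a \<Rightarrow> 'a \<times> 'a \<Rightarrow> 'a \<times> 'a \<Rightarrow> bool" where
  "decomposition G g h p \<rho> x y \<longleftrightarrow>
     x \<in> word_set G \<and> y \<in> word_set G \<and>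
     x \<notin> lang' G g h p \<and> y \<notin> lang' G g h p \<and>
     x \<otimes>\<^bsub>G \<times>\<times> G\<^esub> y = \<rho>"

text \<open>
  An adversary is an arbitrary randomized function, with no bound on its resources, from the
  challenge \<open>\<rho>\<close> to a word. The pmf below is the joint distribution of challenge and output.
\<close>

definition decomposition_game ::
  "('a, 'b) monoid_scheme \<Rightarrow> ('a \<times> 'a \<Rightarrow> ('a \<times> 'a) pmf) \<Rightarrow> (('a \<times> 'a) \<times> ('a \<times> 'a)) pmf" where
  "decomposition_game G A =
     bind_pmf (pmf_of_set (word_set G)) (\<lambda>\<rho>. map_pmf (\<lambda>x. (\<rho>, x)) (A \<rho>))"

end

theory Submission
  imports Defs "HOL-Algebra.Elementary_Groups" "HOL-Algebra.Multiplicative_Group"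
begin

text \<open>
  Writing words in terms of exponents of \<open>g\<close>, with \<open>h = g\<^sup>s\<close>, a word \<open>(g\<^sup>a, g\<^sup>b)\<close> lies in the
  language iff \<open>b - s a\<close> vanishes modulo \<open>p\<close>. This quantity is the determinant of the linear map
  sending \<open>(\<alpha>, \<beta>)\<close> to the exponents of the projection key and the hash value, so off the language
  that pair is uniform on \<open>\<G>\<^sup>2\<close>. Finally, the language is closed under multiplication and
  has at most \<open>p\<close> elements, so a random challenge lies in it with probability at most \<open>1/p\<close>;
  outside of it no decomposition exists.
\<close>

lemma pair_pmf_of_set:
  assumes "finite A" "A \<noteq> {}" "finite B" "B \<noteq> {}"
  shows "pair_pmf (pmf_of_set A) (pmf_of_set B) = pmf_of_set (A \<times> B)"
proof (rule pmf_eqI)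
  fix z :: "'a \<times> 'b"
  show "pmf (pair_pmf (pmf_of_set A) (pmf_of_set B)) z = pmf (pmf_of_set (A \<times> B)) z"
    using assms by (cases z) (simp add: pmf_pair indicator_times card_cartesian_product)
qed

text \<open>Divisibility is taken over the integers, where differences of exponents may be negative
  instead of being truncated at zero.\<close>

lemma (in group) nat_pow_eq_iff:
  assumes "x \<in> carrier G"
  shows "x [^] (m :: nat) = x [^] (n :: nat) \<longleftrightarrow> int (ord x) dvd int n - int m"
  using int_pow_eq[OF assms, of "int m" "int n"] by (simp add: int_pow_int)

text \<open>Subtracting \<open>a\<close> times the first form from the second eliminates
  \<open>d\<close> and leaves \<open>(b - s * a) * e\<close>. The determinant is a unit modulo the
  prime \<open>q\<close>, so \<open>e\<close> vanishes, and then \<open>d\<close> does too.\<close>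

lemma linear_map_mod_prime_inj:
  fixes q a b s d e :: int
  assumes q: "prime q" and det: "\<not> q dvd b - s * a"
    and 1: "q dvd d + s * e" and 2: "q dvd a * d + b * e"
  shows "q dvd d \<and> q dvd e"
proof -
  have "q dvd (a * d + b * e) - a * (d + s * e)"
    using 1 2 by (intro dvd_diff dvd_mult)
  also have "(a * d + b * e) - a * (d + s * e) = (b - s * a) * e"
    by (simp add: algebra_simps)
  finally have e: "q dvd e"
    using q det by (simp add: prime_dvd_mult_iff)
  then have "q dvd (d + s * e) - s * e"
    using 1 by (intro dvd_diff dvd_mult)
  then show ?thesis
    using e by simp
qed

lemma eq_of_dvd_diff_less:
  fixes m n p :: nat
  assumes "int p dvd int m - int n" "m < p" "n < p"
  shows "m = n"
  using assms dvd_imp_le_int[of "int m - int n" "int p"] by linarith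

locale prime_cyclic_group = group G for G (structure) +
  fixes g h :: 'a and p :: nat
  assumes g_closed: "g \<in> carrier G"
    and generated: "carrier G = generate G {g}"
    and order_eq: "Coset.order G = p"
    and prime_p: "prime p"
    and h_closed: "h \<in> carrier G"
begin

lemma finite_carrier: "finite (carrier G)"
  using order_eq prime_p by (metis order_gt_0_iff_finite prime_gt_0_nat)

lemma ord_g: "ord g = p"
  using generate_pow_card[OF g_closed] generated order_eq by (simp add: Coset.order_def)

lemma carrier_eq_pow: "carrier G = {g [^] k | k :: nat. True}"
  using generate_pow_on_finite_carrier[OF finite_carrier g_closed] generated by auto

lemma g_pow_eq_iff:
  "g [^] (m :: nat) = g [^] (n :: nat) \<longleftrightarrow> int p dvd int n - int m"
  using nat_pow_eq_iff[OF g_closed] ord_g by simp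

text \<open>Only a group with a generator is assumed; commutativity comes from cyclicity and is what
  lets powers distribute over products below.\<close>

lemma is_comm_group: "comm_group G"
proof (rule cyclic_imp_abelian_group, unfold cyclic_group, intro bexI[OF _ g_closed] equalityI subsetI)
  fix x assume "x \<in> carrier G"
  then obtain k :: nat where "x = g [^] k"
    using carrier_eq_pow by auto
  then have "x = g [^] int k"
    by (simp add: int_pow_int)
  then show "x \<in> range (\<lambda>n::int. g [^] n)"
    by blast
qed (use g_closed in auto)

sublocale comm_group G
  by (rule is_comm_group)

lemma pow_mod_p:
  assumes "x \<in> carrier G"
  shows "x [^] (n mod p) = x [^] n"
proof -
  have "x [^] n = (x [^] p) [^] (n div p) \<otimes> x [^] (n mod p)"
    using assms by (simp add: nat_pow_pow nat_pow_mult)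
  then show ?thesis
    using assms pow_order_eq_1[OF assms] by (simp add: order_eq)
qed

text \<open>By Lagrange, exponents matter only modulo \<open>p\<close>. Dropping the bound on the
  witness lets witnesses be added without reduction.\<close>

lemma lang_eq: "lang G g h p = {(g [^] r, h [^] r) | r :: nat. True}"
proof -
  have "(g [^] r, h [^] r) \<in> lang G g h p" for r :: nat
    using g_closed h_closed prime_gt_0_nat[OF prime_p]
    by (auto simp: lang_def Zp_def pow_mod_p intro!: exI[of _ "r mod p"])
  then show ?thesis
    by (auto simp: lang_def)
qed

lemma hash_val_lang:
  "hash_val G (\<alpha>, \<beta>) (g [^] r, h [^] r) = proj_hash G (proj_key G g h (\<alpha>, \<beta>)) x (r :: nat)"
  using g_closed h_closed
  by (simp add: proj_hash_def nat_pow_distrib nat_pow_pow mult.commute)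

text \<open>In exponents the map is linear with rows \<open>(1, s)\<close> and
  \<open>(a, b)\<close>. Off the language its determinant \<open>b - s * a\<close> is nonzero modulo
  \<open>p\<close>, so it is injective; both sides have \<open>p * p\<close> elements, so it is also
  onto.\<close>

lemma bij_betw_proj_key_hash_val:
  assumes x: "x \<in> word_set G - lang G g h p"
  shows "bij_betw (\<lambda>hk. (proj_key G g h hk, hash_val G hk x)) (Zp p \<times> Zp p)
    (carrier G \<times> carrier G)"
proof -
  obtain u v where uv: "x = (u, v)" "u \<in> carrier G" "v \<in> carrier G"
    using x by (auto simp: word_set_def)
  obtain a b s :: nat where abs: "u = g [^] a" "v = g [^] b" "h = g [^] s"
    using uv h_closed by (auto simp: carrier_eq_pow)
  \<comment> \<open>Otherwise \<open>h [^] a = g [^] (s * a) = g [^] b = v\<close>, and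
    \<open>a\<close> would be a witness for \<open>x\<close>.\<close>
  have det: "\<not> int p dvd int b - int s * int a"
  proof
    assume "int p dvd int b - int s * int a"
    then have "h [^] a = v"
      using g_closed g_pow_eq_iff[of "s * a" b] by (simp add: abs nat_pow_pow)
    then show False
      using x uv(1) abs(1) lang_eq by auto
  qed
  let ?F = "\<lambda>hk. (proj_key G g h hk, hash_val G hk x)"
  have F: "?F (\<alpha>, \<beta>) = (g [^] (\<alpha> + s * \<beta>), g [^] (a * \<alpha> + b * \<beta>))" for \<alpha> \<beta>
    using g_closed by (simp add: uv abs nat_pow_pow nat_pow_mult)
  have inj: "inj_on ?F (Zp p \<times> Zp p)"
  proof (rule inj_onI, clarify)
    fix \<alpha> \<beta> \<alpha>' \<beta>'
    assume mem: "\<alpha> \<in> Zp p" "\<beta> \<in> Zp p" "\<alpha>' \<in> Zp p" "\<beta>' \<in> Zp p"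
      and eq: "proj_key G g h (\<alpha>, \<beta>) = proj_key G g h (\<alpha>', \<beta>')"
        "hash_val G (\<alpha>, \<beta>) x = hash_val G (\<alpha>', \<beta>') x"
    let ?d = "int \<alpha>' - int \<alpha>" and ?e = "int \<beta>' - int \<beta>"
    have "int p dvd ?d + int s * ?e" "int p dvd int a * ?d + int b * ?e"
      using eq F[of \<alpha> \<beta>] F[of \<alpha>' \<beta>'] by (simp_all add: g_pow_eq_iff algebra_simps)
    then have "int p dvd ?d \<and> int p dvd ?e"
      using prime_p det by (intro linear_map_mod_prime_inj[where a = "int a" and b = "int b" and s = "int s"]) auto
    \<comment> \<open>Canonical representatives differ by less than \<open>p\<close>, so congruent
      ones coincide.\<close>
    then show "\<alpha> = \<alpha>' \<and> \<beta> = \<beta>'"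
      using mem by (auto simp: Zp_def dest: eq_of_dvd_diff_less)
  qed
  moreover have "?F ` (Zp p \<times> Zp p) \<subseteq> carrier G \<times> carrier G"
    using F g_closed by auto
  moreover have "card (?F ` (Zp p \<times> Zp p)) = card (carrier G \<times> carrier G)"
    unfolding card_image[OF inj] using order_eq by (simp add: card_cartesian_product Coset.order_def Zp_def)
  ultimately show ?thesis
    unfolding bij_betw_def using finite_carrier by (intro conjI card_subset_eq finite_cartesian_product)
qed

text \<open>The bijection carries the uniform law on keys to the uniform law on pairs of group
  elements, whose coordinates are independent and uniform.\<close>

lemma smoothness:
  assumes "x \<in> word_set G - lang G g h p"
  shows "map_pmf (\<lambda>hk. (proj_key G g h hk, hash_val G hk x)) (hash_key p) =
    pair_pmf (map_pmf (proj_key G g h) (hash_key p)) (pmf_of_set (carrier G))"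
proof -
  have ne: "carrier G \<noteq> {}"
    using g_closed by blast
  have joint: "map_pmf (\<lambda>hk. (proj_key G g h hk, hash_val G hk x)) (hash_key p) =
      pair_pmf (pmf_of_set (carrier G)) (pmf_of_set (carrier G))"
    unfolding hash_key_def
    using map_pmf_of_set_bij_betw[OF bij_betw_proj_key_hash_val[OF assms]]
      finite_carrier ne prime_gt_0_nat[OF prime_p]
    by (auto simp: pair_pmf_of_set Zp_def)
  \<comment> \<open>The law of the projection key is the first marginal of the joint law, hence
    uniform on the group.\<close>
  have "map_pmf (proj_key G g h) (hash_key p) =
      map_pmf fst (map_pmf (\<lambda>hk. (proj_key G g h hk, hash_val G hk x)) (hash_key p))"
    by (simp add: pmf.map_comp o_def)
  then have "map_pmf (proj_key G g h) (hash_key p) = pmf_of_set (carrier G)"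
    by (simp add: joint map_fst_pair_pmf)
  then show ?thesis
    by (simp add: joint)
qed

text \<open>The grey zone is empty, so words outside \<open>lang'\<close> lie in
  \<open>lang\<close>; the sum of their witnesses is a witness for the product.\<close>

lemma decomposition_imp_lang:
  assumes "decomposition G g h p \<rho> x y"
  shows "\<rho> \<in> lang G g h p"
proof -
  have "x \<in> lang G g h p" "y \<in> lang G g h p"
    using assms by (auto simp: decomposition_def lang'_def)
  then obtain r r' :: nat where "x = (g [^] r, h [^] r)" "y = (g [^] r', h [^] r')"
    by (auto simp: lang_eq)
  then have "\<rho> = (g [^] (r + r'), h [^] (r + r'))"
    using assms g_closed h_closed by (auto simp: decomposition_def nat_pow_mult)
  then show ?thesis
    by (auto simp: lang_eq)
qed

text \<open>At most \<open>p\<close> words, one per witness, out of \<open>p * p\<close>.\<close>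

lemma prob_lang_le: "measure_pmf.prob (pmf_of_set (word_set G)) (lang G g h p) \<le> 1 / real p"
proof -
  have lang_image: "lang G g h p = (\<lambda>r. (g [^] r, h [^] r)) ` Zp p"
    by (auto simp: lang_def)
  then have "card (word_set G \<inter> lang G g h p) \<le> card (lang G g h p)"
    by (intro card_mono) (auto simp: Zp_def)
  also have "\<dots> \<le> p"
    unfolding lang_image using card_image_le[of "Zp p"] by (simp add: Zp_def)
  finally have "real (card (word_set G \<inter> lang G g h p)) / real (p * p) \<le> real p / real (p * p)"
    by (intro divide_right_mono) auto
  moreover have "card (word_set G) = p * p"
    using order_eq by (simp add: word_set_def card_cartesian_product Coset.order_def)
  moreover have "finite (word_set G)" "word_set G \<noteq> {}"
    using finite_carrier g_closed by (auto simp: word_set_def)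
  ultimately show ?thesis
    using prime_gt_0_nat[OF prime_p] by (simp add: measure_pmf_of_set)
qed

lemma prob_decomposition_le:
  "measure_pmf.prob (pmf_of_set (word_set G)) {\<rho>. \<exists>x y. decomposition G g h p \<rho> x y} \<le> 1 / real p"
  by (rule order_trans[OF measure_pmf.finite_measure_mono prob_lang_le])
    (auto dest: decomposition_imp_lang)

text \<open>Winning forces the challenge into the language, and the challenge is uniform whatever
  \<open>A\<close> does with it.\<close>

lemma prob_decomposition_game_le:
  "measure_pmf.prob (decomposition_game G A) {(\<rho>, x). \<exists>y. decomposition G g h p \<rho> x y} \<le> 1 / real p"
proof -
  have "measure_pmf.prob (decomposition_game G A) {(\<rho>, x). \<exists>y. decomposition G g h p \<rho> x y}
      \<le> measure_pmf.prob (decomposition_game G A) (fst -` lang G g h p)"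
    by (rule measure_pmf.finite_measure_mono) (auto dest: decomposition_imp_lang)
  also have "\<dots> = measure_pmf.prob (map_pmf fst (decomposition_game G A)) (lang G g h p)"
    by simp
  also have "map_pmf fst (decomposition_game G A) = pmf_of_set (word_set G)"
    by (simp add: decomposition_game_def map_bind_pmf pmf.map_comp o_def bind_return_pmf')
  finally show ?thesis
    using prob_lang_le by simp
qed

end

theorem mainTheorem2:
  fixes G :: "('a, 'b) monoid_scheme" and g h :: 'a and p :: nat
  assumes "group G"
    and "g \<in> carrier G" and "carrier G = generate G {g}"
    and "Coset.order G = p" and "prime p"
    and "h \<in> carrier G"
  shows
    "(\<forall>x r \<alpha> \<beta>. r \<in> Zp p \<longrightarrow> x = (g [^]\<^bsub>G\<^esub> r, h [^]\<^bsub>G\<^esub> r) \<longrightarrow> \<alpha> \<in> Zp p \<longrightarrow> \<beta> \<in> Zp p \<longrightarrow>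
        hash_val G (\<alpha>, \<beta>) x = proj_hash G (proj_key G g h (\<alpha>, \<beta>)) x r)
     \<and>
     (\<forall>x \<in> word_set G - lang G g h p.
        map_pmf (\<lambda>hk. (proj_key G g h hk, hash_val G hk x)) (hash_key p) =
        pair_pmf (map_pmf (proj_key G g h) (hash_key p)) (pmf_of_set (carrier G)))
     \<and>
     measure_pmf.prob (pmf_of_set (word_set G)) {\<rho>. \<exists>x y. decomposition G g h p \<rho> x y}
        \<le> 1 / real p
     \<and>
     (\<forall>(A :: nat \<Rightarrow> 'a \<times> 'a \<Rightarrow> ('a \<times> 'a) pmf) sk. sk \<in> Zp p \<longrightarrow> h = g [^]\<^bsub>G\<^esub> sk \<longrightarrow>
        measure_pmf.prob (decomposition_game G (A sk))
          {(\<rho>, x). \<exists>y. decomposition G g h p \<rho> x y} \<le> 1 / real p)"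
proof -
  interpret prime_cyclic_group G g h p
    using assms by (auto simp: prime_cyclic_group_def prime_cyclic_group_axioms_def)
  show ?thesis
    \<comment> \<open>The game bound holds for every adversary, so \<open>A sk\<close>, which is
      given the discrete logarithm, is just one instance.\<close>
    using hash_val_lang smoothness prob_decomposition_le prob_decomposition_game_le by blast
qed

end
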